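(* Let $p>3$ be a prime, and let $\{A_k\}_{k\ge0}$ be an even sequence of rational numbers such that $A_0,A_1,\ldots,A_{p-2},A_p$ and $pA_{p-1}$ are rational $p$-integers. Then $$\sum_{k=1}^{p-2}\frac{A_k}{p-k}\equiv\frac{2A_p-A_0-pA_{p-1}}{p}\pmod{p^2}.$$
   Context: A sequence $\{a_n\}_{n\ge0}$ is called an even sequence if $\sum_{k=0}^n\binom nk(-1)^ka_k=a_n$ for all $n=0,1,2,\ldots$. A rational $p$-integer is a rational number whose denominator (in lowest terms) is coprime to $p$; $\mathbb Z_p$ denotes the set of such numbers. For rational numbers $x,y$, $x\equiv y\pmod{p^2}$ means $(x-y)/p^2\in\mathbb Z_p$. *)

theory Defs
  imports Complex_Main "HOL-Computational_Algebra.Primes"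
begin

definition even_sequence :: "(nat \<Rightarrow> rat) \<Rightarrow> bool" where
  "even_sequence a \<longleftrightarrow> (\<forall>n. (\<Sum>k=0..n. of_nat (n choose k) * (-1) ^ k * a k) = a n)"

(* The second component of quotient_of is the positive denominator in lowest terms. *)
definition p_integers :: "nat \<Rightarrow> rat set" where
  "p_integers p = {x. coprime (snd (quotient_of x)) (int p)}"

(* x is congruent to y modulo p ^ m. As in the source, x and y themselves are arbitrary
   rationals; only the quotient (x - y) / p ^ m is required to be a p-integer. *)
definition rat_cong :: "nat \<Rightarrow> nat \<Rightarrow> rat \<Rightarrow> rat \<Rightarrow> bool" where
  "rat_cong p m x y \<longleftrightarrow> (x - y) / of_nat p ^ m \<in> p_integers p"

end

theory Submission
  imports Defs
begin

text \<open>
  Write \<open>H k\<close> for the harmonic numbers. The defining identity of an even sequence at \<open>n = p\<close> and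
  \<open>(p choose k) = p / (p - k) * (p - 1 choose k)\<close> turn the right-hand side into the sum of
  \<open>A k / (p - k) * (-1)^k * (p - 1 choose k)\<close>. As \<open>(-1)^k * (p - 1 choose k)\<close> is \<open>1 - p * H k\<close> modulo
  \<open>p^2\<close>, it remains to see that the sum \<open>S\<close> of \<open>H k / k * A k\<close> over \<open>1 \<le> k \<le> p - 2\<close> vanishes modulo \<open>p\<close>.
  Modulo \<open>p\<close> the row vector \<open>H k / k\<close> is an eigenvector with eigenvalue \<open>-1\<close> of the binomial
  involution that fixes \<open>A\<close>, whence \<open>S \<equiv> -S\<close>.
\<close>

section \<open>Exact identities for harmonic numbers and binomial sums\<close>

definition harmonic :: "nat \<Rightarrow> rat" where
  "harmonic n = (\<Sum>k=1..n. 1 / of_nat k)"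

lemma harmonic_0 [simp]: "harmonic 0 = 0"
  by (simp add: harmonic_def)

lemma harmonic_Suc: "harmonic (Suc n) = harmonic n + 1 / of_nat (Suc n)"
  by (simp add: harmonic_def)

text \<open>Telescoping: the increment of \<open>harmonic n ^ 2\<close> is
  \<open>2 * harmonic n / n - 1 / n ^ 2\<close>. Needed for column \<open>0\<close> of the
  eigenvector relation.\<close>

lemma sum_harmonic_div:
  "2 * (\<Sum>n=1..N. harmonic n / of_nat n) = harmonic N ^ 2 + (\<Sum>n=1..N. 1 / of_nat n ^ 2)"
proof (induction N)
  case (Suc N)
  define c :: rat where "c = 1 / of_nat (Suc N)"
  have "2 * (\<Sum>n=1..Suc N. harmonic n / of_nat n)
      = 2 * (\<Sum>n=1..N. harmonic n / of_nat n) + 2 * (harmonic (Suc N) * c)"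
    by (simp add: c_def distrib_left)
  also have "\<dots> = harmonic N ^ 2 + (\<Sum>n=1..N. 1 / of_nat n ^ 2) + 2 * ((harmonic N + c) * c)"
    unfolding Suc harmonic_Suc c_def ..
  also have "\<dots> = (harmonic N + c) ^ 2 + ((\<Sum>n=1..N. 1 / of_nat n ^ 2) + c ^ 2)"
    by (simp add: power2_eq_square algebra_simps)
  also have "\<dots> = harmonic (Suc N) ^ 2 + (\<Sum>n=1..Suc N. 1 / of_nat n ^ 2)"
    by (simp add: harmonic_Suc c_def power_divide)
  finally show ?case .
qed simp

text \<open>Summation by parts: \<open>(n - 1) choose k\<close> is the increment of
  \<open>n choose Suc k\<close>, and \<open>1 / n\<close> that of \<open>harmonic n\<close>.\<close>

lemma sum_choose_harmonic:
  "(\<Sum>n=1..N. of_nat ((n - 1) choose k) * harmonic n)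
    = of_nat (N choose Suc k) * harmonic N
      - (\<Sum>n=1..N. of_nat ((n - 1) choose Suc k) / of_nat n)"
proof (induction N)
  case (Suc N)
  then show ?case
    by (simp add: harmonic_Suc algebra_simps add_divide_distrib)
qed simp

lemma choose_div_of_nat:
  assumes "n \<ge> 1"
  shows "of_nat (n choose Suc k) / (of_nat n :: rat) = of_nat ((n - 1) choose k) / of_nat (Suc k)"
proof -
  obtain m where n: "n = Suc m" using assms by (cases n) auto
  have "of_nat (Suc k * (Suc m choose Suc k)) = (of_nat (Suc m * (m choose k)) :: rat)"
    by (simp only: Suc_times_binomial)
  then show ?thesis
    unfolding n of_nat_mult by (subst frac_eq_eq) (simp_all add: mult.commute del: binomial_Suc_Suc of_nat_Suc)
qed

lemma sum_choose_pred: "(\<Sum>n=1..N. (n - 1) choose k) = N choose Suc k"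
  by (induction N) auto

text \<open>Pascal's rule merges the two sums, absorption removes the denominator \<open>n\<close>,
  and the hockey-stick identity evaluates the rest. The result serves as a recursion in
  \<open>k\<close>.\<close>

lemma sum_choose_pred_div:
  "(\<Sum>n=1..N. of_nat ((n - 1) choose Suc k) / of_nat n) + (\<Sum>n=1..N. of_nat ((n - 1) choose k) / of_nat n)
    = (of_nat (N choose Suc k) / of_nat (Suc k) :: rat)"
proof -
  have "(\<Sum>n=1..N. of_nat ((n - 1) choose Suc k) / of_nat n) + (\<Sum>n=1..N. of_nat ((n - 1) choose k) / of_nat n)
    = (\<Sum>n=1..N. of_nat (n choose Suc k) / (of_nat n :: rat))"
    unfolding sum.distrib [symmetric]
  proof (rule sum.cong [OF refl])
    fix n assume "n \<in> {1..N}"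
    then obtain m where "n = Suc m" by (cases n) auto
    then show "of_nat ((n - 1) choose Suc k) / of_nat n + of_nat ((n - 1) choose k) / of_nat n
      = (of_nat (n choose Suc k) / of_nat n :: rat)"
      by (simp add: add_divide_distrib del: of_nat_Suc)
  qed
  also have "\<dots> = (\<Sum>n=1..N. of_nat ((n - 1) choose k) / of_nat (Suc k))"
    by (rule sum.cong [OF refl], rule choose_div_of_nat) simp
  also have "\<dots> = of_nat (\<Sum>n=1..N. (n - 1) choose k) / of_nat (Suc k)"
    by (simp add: sum_divide_distrib)
  finally show ?thesis
    unfolding sum_choose_pred .
qed

section \<open>The ring of rational \<open>p\<close>-integers\<close>

text \<open>Any denominator coprime to \<open>p\<close> will do, because the reduced denominator
  divides it. The closure proofs thus never have to reduce a fraction.\<close>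

lemma p_integersI:
  assumes "coprime b (int p)" "x * of_int b = of_int a" "b \<noteq> 0"
  shows "x \<in> p_integers p"
proof -
  obtain c d where q: "quotient_of x = (c, d)" by fastforce
  have d: "d > 0" and cop: "coprime c d" and x: "x = of_int c / of_int d"
    using q quotient_of_denom_pos quotient_of_coprime quotient_of_div by auto
  have "(of_int (c * b) :: rat) = of_int (a * d)"
    using assms(2) d unfolding x by (simp add: field_simps)
  then have "c * b = a * d" by (simp only: of_int_eq_iff)
  then have "d dvd b"
    using cop by (metis coprime_commute coprime_dvd_mult_right_iff dvd_triv_right)
  then have "coprime d (int p)"
    using assms(1) by (meson coprime_divisors dvd_refl)
  then show ?thesis by (simp add: p_integers_def q)
qed

lemma p_integersE:
  assumes "x \<in> p_integers p"
  obtains a b where "coprime b (int p)" "x * of_int b = of_int a" "b \<noteq> 0"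
proof -
  obtain c d where q: "quotient_of x = (c, d)" by fastforce
  have "d > 0" "x = of_int c / of_int d"
    using q quotient_of_denom_pos quotient_of_div by auto
  moreover have "coprime d (int p)"
    using assms by (simp add: p_integers_def q)
  ultimately show ?thesis by (intro that [of d c]) auto
qed

lemma p_integers_add:
  assumes "x \<in> p_integers p" "y \<in> p_integers p"
  shows "x + y \<in> p_integers p"
proof -
  obtain a b where 1: "coprime b (int p)" "x * of_int b = of_int a" "b \<noteq> 0"
    using assms(1) by (rule p_integersE)
  obtain c d where 2: "coprime d (int p)" "y * of_int d = of_int c" "d \<noteq> 0"
    using assms(2) by (rule p_integersE)
  show ?thesis
  proof (rule p_integersI)
    show "coprime (b * d) (int p)" using 1 2 by simp
    have "(x + y) * of_int (b * d) = (x * of_int b) * of_int d + (y * of_int d) * of_int b"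
      by (simp add: algebra_simps)
    then show "(x + y) * of_int (b * d) = of_int (a * d + c * b)"
      using 1 2 by simp
  qed (use 1 2 in auto)
qed

lemma p_integers_mult:
  assumes "x \<in> p_integers p" "y \<in> p_integers p"
  shows "x * y \<in> p_integers p"
proof -
  obtain a b where 1: "coprime b (int p)" "x * of_int b = of_int a" "b \<noteq> 0"
    using assms(1) by (rule p_integersE)
  obtain c d where 2: "coprime d (int p)" "y * of_int d = of_int c" "d \<noteq> 0"
    using assms(2) by (rule p_integersE)
  show ?thesis
  proof (rule p_integersI)
    show "coprime (b * d) (int p)" using 1 2 by simp
    have "(x * y) * of_int (b * d) = (x * of_int b) * (y * of_int d)"
      by (simp add: algebra_simps)
    then show "(x * y) * of_int (b * d) = of_int (a * c)"
      using 1 2 by simp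
  qed (use 1 2 in auto)
qed

lemma p_integers_of_int [simp]: "of_int a \<in> p_integers p"
  by (rule p_integersI [of 1 _ _ a]) auto

lemma p_integers_of_nat [simp]: "of_nat n \<in> p_integers p"
  using p_integers_of_int [of "int n"] by simp

lemma p_integers_0 [simp]: "0 \<in> p_integers p"
  and p_integers_1 [simp]: "1 \<in> p_integers p"
  using p_integers_of_nat [of 0 p] p_integers_of_nat [of 1 p] by auto

lemma p_integers_uminus: "x \<in> p_integers p \<Longrightarrow> - x \<in> p_integers p"
  using p_integers_mult [OF p_integers_of_int [of "-1"], of x p] by simp

lemma p_integers_power: "x \<in> p_integers p \<Longrightarrow> x ^ n \<in> p_integers p"
  by (induction n) (auto intro: p_integers_mult)

lemma p_integers_sum: "(\<And>i. i \<in> I \<Longrightarrow> f i \<in> p_integers p) \<Longrightarrow> sum f I \<in> p_integers p"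
  by (induction I rule: infinite_finite_induct) (auto intro: p_integers_add)

lemma p_integers_inverse:
  assumes "coprime n p" "n > 0"
  shows "1 / of_nat n \<in> p_integers p"
  using assms by (intro p_integersI [of "int n" _ _ 1]) auto

lemma p_integers_inverse_less:
  assumes "prime p" "0 < n" "n < p"
  shows "1 / of_nat n \<in> p_integers p"
proof (rule p_integers_inverse)
  have "\<not> p dvd n" using assms by (auto dest: dvd_imp_le)
  then show "coprime n p"
    using assms(1) by (metis prime_imp_coprime coprime_commute)
qed fact

lemma p_integers_harmonic:
  assumes "prime p" "n < p"
  shows "harmonic n \<in> p_integers p"
  unfolding harmonic_def using assms by (intro p_integers_sum p_integers_inverse_less) auto

section \<open>Congruences of rationals modulo powers of \<open>p\<close>\<close>

lemma rat_cong_refl [simp]: "rat_cong p m x x"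
  by (simp add: rat_cong_def)

lemma rat_cong_sym: "rat_cong p m x y \<Longrightarrow> rat_cong p m y x"
  unfolding rat_cong_def using p_integers_uminus
  by (metis minus_diff_eq minus_divide_left)

lemma rat_cong_add: "rat_cong p m x y \<Longrightarrow> rat_cong p m x' y' \<Longrightarrow> rat_cong p m (x + x') (y + y')"
  unfolding rat_cong_def using p_integers_add
  by (metis add_diff_add add_divide_distrib)

lemma rat_cong_trans [trans]:
  "rat_cong p m x y \<Longrightarrow> rat_cong p m y z \<Longrightarrow> rat_cong p m x z"
  using rat_cong_add [of p m x y y z] by (simp add: rat_cong_def)

lemma rat_cong_mult_left:
  "rat_cong p m x y \<Longrightarrow> c \<in> p_integers p \<Longrightarrow> rat_cong p m (c * x) (c * y)"
  unfolding rat_cong_def using p_integers_mult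
  by (metis right_diff_distrib times_divide_eq_right)

lemma rat_cong_uminus: "rat_cong p m x y \<Longrightarrow> rat_cong p m (- x) (- y)"
  using rat_cong_mult_left [OF _ p_integers_of_int, of p m x y "-1"] by simp

lemma rat_cong_diff: "rat_cong p m x y \<Longrightarrow> rat_cong p m x' y' \<Longrightarrow> rat_cong p m (x - x') (y - y')"
  using rat_cong_add [OF _ rat_cong_uminus, of p m x y x' y'] by simp

text \<open>The passage goes through \<open>y * x'\<close>, so exactly the two factors held fixed,
  \<open>x'\<close> and then \<open>y\<close>, have to be \<open>p\<close>-integral.\<close>

lemma rat_cong_mult:
  assumes "rat_cong p m x y" "rat_cong p m x' y'" "x' \<in> p_integers p" "y \<in> p_integers p"
  shows "rat_cong p m (x * x') (y * y')"
  using rat_cong_trans [OF rat_cong_mult_left [OF assms(1,3)], of "y * y'"]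
    rat_cong_mult_left [OF assms(2,4)] by (simp add: mult.commute)

lemma rat_cong_sum:
  "(\<And>i. i \<in> I \<Longrightarrow> rat_cong p m (f i) (g i)) \<Longrightarrow> rat_cong p m (sum f I) (sum g I)"
  by (induction I rule: infinite_finite_induct) (auto intro: rat_cong_add)

lemma rat_cong_of_nat_mult:
  assumes "p > 0" "x \<in> p_integers p"
  shows "rat_cong p 1 (of_nat p * x) 0"
  using assms by (simp add: rat_cong_def)

text \<open>A factor \<open>p\<close> raises the modulus, so terms of first order in
  \<open>p\<close> need to be known only modulo \<open>p\<close>.\<close>

lemma rat_cong_Suc_mult:
  assumes "p > 0" "rat_cong p m x y"
  shows "rat_cong p (Suc m) (of_nat p * x) (of_nat p * y)"
  using assms by (simp add: rat_cong_def flip: right_diff_distrib)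

lemma rat_cong_Suc_imp:
  assumes "p > 0" "rat_cong p (Suc m) x y"
  shows "rat_cong p m x y"
proof -
  have "(x - y) / of_nat p ^ m = of_nat p * ((x - y) / of_nat p ^ Suc m)"
    using assms(1) by simp
  then show ?thesis
    using assms(2) unfolding rat_cong_def by (metis p_integers_mult p_integers_of_nat)
qed

lemma rat_cong_cancel:
  assumes "coprime n p" "n > 0" "rat_cong p m (of_nat n * x) (of_nat n * y)"
  shows "rat_cong p m x y"
  using rat_cong_mult_left [OF assms(3) p_integers_inverse [OF assms(1,2)]] assms(2) by simp

section \<open>Inverse power sums and binomial coefficients modulo a prime\<close>

text \<open>Doubling permutes the nonzero residues, so the sum is congruent to \<open>2 ^ j\<close>
  times itself, and \<open>2 ^ j - 1\<close> is invertible modulo \<open>p\<close>. Used for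
  \<open>j = 1\<close> and \<open>j = 2\<close>.\<close>

lemma sum_inverse_power_cong_0:
  assumes p: "prime p" "p > 2" and cop: "coprime (2 ^ j - 1) p" and j: "j > 0"
  shows "rat_cong p 1 (\<Sum>n=1..p-1. 1 / of_nat n ^ j) 0"
proof -
  define f :: "nat \<Rightarrow> rat" where "f n = 1 / of_nat n ^ j" for n
  define d where "d m = 2 * m mod p" for m
  have ndvd: "\<not> p dvd 2 * m" if "m \<in> {1..p-1}" for m
    using that p prime_dvd_mult_iff [OF p(1), of 2 m] by (auto dest!: dvd_imp_le)
  have sub: "d ` {1..p-1} \<subseteq> {1..p-1}"
  proof
    fix y assume "y \<in> d ` {1..p-1}"
    then obtain m where m: "m \<in> {1..p-1}" "y = 2 * m mod p" by (auto simp: d_def)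
    then have "y \<noteq> 0" using ndvd by (auto simp: dvd_eq_mod_eq_0)
    moreover have "y < p" using m p by simp
    ultimately show "y \<in> {1..p-1}" by auto
  qed
  have inj: "inj_on d {1..p-1}"
  proof (rule linorder_inj_onI')
    fix a b assume ab: "a \<in> {1..p-1}" "b \<in> {1..p-1}" "a < b"
    show "d a \<noteq> d b"
    proof
      assume "d a = d b"
      then have "p dvd 2 * b - 2 * a"
        unfolding d_def using ab by (subst mod_eq_dvd_iff_nat [symmetric]) auto
      then have "p dvd 2 * (b - a)" by (simp add: diff_mult_distrib2)
      moreover have "b - a \<in> {1..p-1}" using ab by auto
      ultimately show False using ndvd by blast
    qed
  qed
  have img: "d ` {1..p-1} = {1..p-1}"
    using endo_inj_surj [OF _ sub inj] by simp
  have f_int: "f m \<in> p_integers p" if "m \<in> {1..p-1}" for m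
    using p_integers_power [OF p_integers_inverse_less [OF p(1), of m], of j] that
    by (auto simp: f_def power_divide)
  have step: "rat_cong p 1 (2 ^ j * f (d m)) (f m)" if m: "m \<in> {1..p-1}" for m
  proof -
    have dm: "d m \<in> {1..p-1}" using sub m by blast
    define q where "q = 2 * m div p"
    have "2 * m = p * q + d m" by (simp add: q_def d_def)
    then have eq: "(2 * of_nat m :: rat) = of_nat p * of_nat q + of_nat (d m)"
      by (metis of_nat_add of_nat_mult of_nat_numeral)
    have pw: "rat_cong p 1 ((2 * of_nat m) ^ i) (of_nat (d m) ^ i)" for i
    proof (induction i)
      case (Suc i)
      have "rat_cong p 1 (2 * of_nat m) (of_nat (d m))"
        unfolding eq using rat_cong_add [OF rat_cong_of_nat_mult rat_cong_refl] p
        by (metis add_0 p_integers_of_nat prime_gt_0_nat)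
      moreover have "2 * of_nat m \<in> p_integers p"
        by (metis p_integers_of_nat of_nat_mult of_nat_numeral)
      ultimately show ?case
        using Suc unfolding power_Suc
        by (intro rat_cong_mult p_integers_power p_integers_of_nat)
    qed simp
    \<comment> \<open>Multiplying by both inverse powers turns a congruence between the powers of
      \<open>2 * m\<close> and \<open>d m\<close> into one between their inverses.\<close>
    have "rat_cong p 1 ((f m * f (d m)) * (2 * of_nat m) ^ j) ((f m * f (d m)) * of_nat (d m) ^ j)"
      by (intro rat_cong_mult_left pw p_integers_mult f_int m dm)
    moreover have "(f m * f (d m)) * (2 * of_nat m) ^ j = 2 ^ j * f (d m)"
      using m by (simp add: f_def power_mult_distrib)
    moreover have "(f m * f (d m)) * of_nat (d m) ^ j = f m"
      using dm by (simp add: f_def)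
    ultimately show ?thesis by (simp only:)
  qed
  have "2 ^ j * (\<Sum>n=1..p-1. f n) = (\<Sum>m=1..p-1. 2 ^ j * f (d m))"
    using sum.reindex [OF inj, of f] unfolding img by (simp add: sum_distrib_left)
  also have "rat_cong p 1 \<dots> (\<Sum>m=1..p-1. f m)"
    using step by (rule rat_cong_sum)
  finally have "rat_cong p 1 (2 ^ j * sum f {1..p-1} - sum f {1..p-1}) (sum f {1..p-1} - sum f {1..p-1})"
    by (rule rat_cong_diff) simp
  moreover have "2 ^ j * sum f {1..p-1} - sum f {1..p-1} = of_nat (2 ^ j - 1) * sum f {1..p-1}"
    by (simp add: left_diff_distrib)
  ultimately have "rat_cong p 1 (of_nat (2 ^ j - 1) * sum f {1..p-1}) (of_nat (2 ^ j - 1) * 0)"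
    by simp
  moreover have "(2::nat) ^ j - 1 > 0" using j one_less_power [of "2::nat" j] by simp
  ultimately have "rat_cong p 1 (sum f {1..p-1}) 0"
    using rat_cong_cancel cop by blast
  then show ?thesis by (simp add: f_def)
qed

lemma harmonic_pred_prime_cong_0:
  assumes "prime p" "p > 2"
  shows "rat_cong p 1 (harmonic (p - 1)) 0"
  using sum_inverse_power_cong_0 [OF assms, of 1] by (simp add: harmonic_def)

text \<open>The left-hand side is the product of \<open>1 - p / i\<close> over
  \<open>1 \<le> i \<le> k\<close>. Its expansion to first order in \<open>p\<close> is carried out
  by induction.\<close>

lemma choose_pred_prime_cong:
  assumes "prime p" "k < p"
  shows "rat_cong p 2 ((-1) ^ k * of_nat ((p - 1) choose k)) (1 - of_nat p * harmonic k)"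
  using assms(2)
proof (induction k)
  case (Suc k)
  have p0: "p > 0" using assms(1) prime_gt_0_nat by blast
  define b :: "nat \<Rightarrow> rat" where "b k = (-1) ^ k * of_nat ((p - 1) choose k)" for k
  define c :: rat where "c = 1 / of_nat (Suc k)"
  have "Suc k * ((p - 1) choose Suc k) = (p - 1 - k) * ((p - 1) choose k)"
    by (metis binomial_absorption binomial_absorb_comp)
  then have "of_nat (Suc k) * (of_nat ((p - 1) choose Suc k) :: rat)
      = of_nat (p - 1 - k) * of_nat ((p - 1) choose k)"
    by (metis of_nat_mult)
  moreover have "of_nat (p - 1 - k) = (of_nat p - of_nat (Suc k) :: rat)"
    using Suc.prems by simp
  ultimately have choose_Suc: "of_nat ((p - 1) choose Suc k) = (of_nat p * c - 1) * (of_nat ((p - 1) choose k) :: rat)"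
    by (simp add: c_def field_simps del: of_nat_Suc)
  have b_Suc: "b (Suc k) = b k - of_nat p * (c * b k)"
    unfolding b_def choose_Suc by (simp add: algebra_simps)
  have IH: "rat_cong p 2 (b k) (1 - of_nat p * harmonic k)"
    using Suc by (simp add: b_def)
  \<comment> \<open>In \<open>b_Suc\<close> the second \<open>b k\<close> carries a factor
    \<open>p\<close>, so its value modulo \<open>p\<close> suffices there.\<close>
  have "rat_cong p 1 (b k) (1 - of_nat p * harmonic k)"
    using rat_cong_Suc_imp [of p 1] IH p0 by (simp add: numeral_2_eq_2)
  also have "rat_cong p 1 \<dots> (1 - 0)"
    using assms Suc.prems p0
    by (intro rat_cong_diff rat_cong_of_nat_mult p_integers_harmonic rat_cong_refl) auto
  finally have "rat_cong p 1 (b k) 1" by simp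
  then have "rat_cong p 1 (c * b k) (c * 1)"
    unfolding c_def using assms Suc.prems
    by (intro rat_cong_mult_left p_integers_inverse_less) auto
  then have "rat_cong p 2 (of_nat p * (c * b k)) (of_nat p * c)"
    using rat_cong_Suc_mult [OF p0, of 1] by (simp add: numeral_2_eq_2)
  then have "rat_cong p 2 (b (Suc k)) (1 - of_nat p * harmonic k - of_nat p * c)"
    unfolding b_Suc by (rule rat_cong_diff [OF IH])
  then show ?case
    by (simp add: b_def c_def harmonic_Suc algebra_simps)
qed simp

lemma choose_pred_prime_cong_1:
  assumes "prime p" "k < p"
  shows "rat_cong p 1 ((-1) ^ k * of_nat ((p - 1) choose k)) 1"
proof -
  have p0: "p > 0" using assms by simp
  have "rat_cong p 1 ((-1) ^ k * of_nat ((p - 1) choose k)) (1 - of_nat p * harmonic k)"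
    using choose_pred_prime_cong [OF assms] rat_cong_Suc_imp [OF p0, of 1]
    by (simp add: numeral_2_eq_2)
  also have "rat_cong p 1 \<dots> (1 - 0)"
    using assms p0
    by (intro rat_cong_diff rat_cong_of_nat_mult p_integers_harmonic rat_cong_refl) auto
  finally show ?thesis by simp
qed

section \<open>The eigenvector of the binomial involution modulo \<open>p\<close>\<close>

text \<open>With its sign, the recursion from \<open>sum_choose_pred_div\<close> adds
  \<open>1 / (k + 1)\<close> modulo \<open>p\<close> at each step, exactly as
  \<open>harmonic\<close> does. Both sides start at \<open>0\<close> modulo \<open>p\<close>, since
  \<open>harmonic (p - 1)\<close> vanishes there.\<close>

lemma sum_choose_pred_div_cong:
  assumes "prime p" "p > 2" "k < p"
  shows "rat_cong p 1 ((-1) ^ k * (\<Sum>n=1..p-1. of_nat ((n - 1) choose k) / of_nat n)) (harmonic k)"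
  using assms(3)
proof (induction k)
  case 0
  then show ?case
    using harmonic_pred_prime_cong_0 [OF assms(1,2)] by (simp add: harmonic_def)
next
  case (Suc k)
  define S :: "nat \<Rightarrow> rat" where "S k = (\<Sum>n=1..p-1. of_nat ((n - 1) choose k) / of_nat n)" for k
  have S_Suc: "S (Suc k) = of_nat ((p - 1) choose Suc k) / of_nat (Suc k) - S k"
    using sum_choose_pred_div [of k "p - 1"] unfolding S_def by (simp only: eq_diff_eq)
  have "(-1) ^ Suc k * S (Suc k)
      = 1 / of_nat (Suc k) * ((-1) ^ Suc k * of_nat ((p - 1) choose Suc k)) + (-1) ^ k * S k"
    unfolding S_Suc by (simp add: algebra_simps del: of_nat_Suc)
  also have "rat_cong p 1 \<dots> (1 / of_nat (Suc k) * 1 + harmonic k)"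
    using Suc assms(1) unfolding S_def
    by (intro rat_cong_add rat_cong_mult_left choose_pred_prime_cong_1 p_integers_inverse_less) auto
  finally show ?case
    by (simp add: S_def harmonic_Suc add.commute)
qed

text \<open>At \<open>k = 0\<close> the right-hand side is the junk value \<open>0\<close> of a division by zero, which happens to be correct.\<close>

lemma binomial_involution_harmonic_div:
  assumes p: "prime p" "p > 3" and k: "k < p"
  shows "rat_cong p 1 (\<Sum>n=1..p-1. (-1) ^ k * of_nat (n choose k) * (harmonic n / of_nat n))
           (- (harmonic k / of_nat k))"
proof (cases k)
  case 0
  have H: "rat_cong p 1 (harmonic (p - 1)) 0"
    using harmonic_pred_prime_cong_0 p by simp
  \<comment> \<open>For inverse squares the factor to invert is \<open>2 ^ 2 - 1 = 3\<close>; here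
    \<open>p > 3\<close> enters.\<close>
  have "\<not> p dvd 3" using p by (auto dest: dvd_imp_le)
  then have "coprime 3 p"
    using p(1) by (metis prime_imp_coprime coprime_commute)
  then have "rat_cong p 1 (\<Sum>n=1..p-1. 1 / of_nat n ^ 2) 0"
    using sum_inverse_power_cong_0 [of p 2] p by simp
  moreover have "rat_cong p 1 (harmonic (p - 1) * harmonic (p - 1)) (harmonic (p - 1) * 0)"
    using p by (intro rat_cong_mult_left p_integers_harmonic H) auto
  ultimately have "rat_cong p 1 (2 * (\<Sum>n=1..p-1. harmonic n / of_nat n)) 0"
    unfolding sum_harmonic_div using rat_cong_add by (fastforce simp: power2_eq_square)
  moreover have "coprime 2 p"
    using p by (simp add: prime_odd_nat)
  ultimately have "rat_cong p 1 (\<Sum>n=1..p-1. harmonic n / of_nat n) 0"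
    using rat_cong_cancel [of 2 p 1 _ 0] by simp
  then show ?thesis by (simp add: 0)
next
  case (Suc i)
  define c :: rat where "c = 1 / of_nat k"
  define S :: rat where "S = (\<Sum>n=1..p-1. of_nat ((n - 1) choose k) / of_nat n)"
  have c: "c \<in> p_integers p"
    unfolding c_def using p k Suc by (intro p_integers_inverse_less) auto
  \<comment> \<open>Absorption trades the denominator \<open>n\<close> for the constant
    \<open>k\<close>, which gives the form required for summation by parts.\<close>
  have "(\<Sum>n=1..p-1. (-1) ^ k * of_nat (n choose k) * (harmonic n / of_nat n))
      = (\<Sum>n=1..p-1. c * (-1) ^ k * (of_nat ((n - 1) choose i) * harmonic n))"
  proof (rule sum.cong [OF refl])
    fix n assume n: "n \<in> {1..p-1}"
    have "(-1) ^ k * of_nat (n choose k) * (harmonic n / of_nat n)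
        = (-1) ^ k * harmonic n * (of_nat (n choose k) / of_nat n)" by simp
    also have "of_nat (n choose k) / of_nat n = c * of_nat ((n - 1) choose i)"
      using choose_div_of_nat [of n i] n unfolding Suc c_def by simp
    finally show "(-1) ^ k * of_nat (n choose k) * (harmonic n / of_nat n)
      = c * (-1) ^ k * (of_nat ((n - 1) choose i) * harmonic n)"
      by (simp only: mult_ac)
  qed
  also have "\<dots> = c * (-1) ^ k * (\<Sum>n=1..p-1. of_nat ((n - 1) choose i) * harmonic n)"
    by (simp only: sum_distrib_left)
  also have "\<dots> = c * ((-1) ^ k * of_nat ((p - 1) choose k) * harmonic (p - 1) - (-1) ^ k * S)"
    unfolding sum_choose_harmonic S_def Suc by (simp only: algebra_simps)
  \<comment> \<open>The boundary term vanishes because it contains \<open>harmonic (p - 1)\<close>;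
    the remaining sum contributes \<open>harmonic k\<close>.\<close>
  also have "rat_cong p 1 \<dots> (c * ((-1) ^ k * of_nat ((p - 1) choose k) * 0 - harmonic k))"
    unfolding S_def using p k
    by (intro rat_cong_mult_left c rat_cong_diff sum_choose_pred_div_cong p_integers_mult
        p_integers_of_nat p_integers_power harmonic_pred_prime_cong_0)
      (auto intro: p_integers_uminus)
  finally show ?thesis by (simp add: c_def)
qed

text \<open>The involution is truncated at \<open>p - 2\<close>, the last index up to which
  \<open>A\<close> is assumed \<open>p\<close>-integral.\<close>

lemma sum_harmonic_even_sequence_cong_0:
  assumes p: "prime p" "p > 3" and A: "even_sequence A"
    and int: "\<And>k. k \<le> p - 2 \<Longrightarrow> A k \<in> p_integers p"
  shows "rat_cong p 1 (\<Sum>k=1..p-2. harmonic k / of_nat k * A k) 0"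
proof -
  define l where "l k = harmonic k / of_nat k" for k
  define T :: "nat \<Rightarrow> nat \<Rightarrow> rat" where "T n k = (-1) ^ k * of_nat (n choose k)" for n k
  have TA: "A n = (\<Sum>k=0..p-2. T n k * A k)" if "n \<le> p - 2" for n
  proof -
    have "A n = (\<Sum>k=0..n. T n k * A k)"
      using A unfolding even_sequence_def T_def by (simp add: mult_ac)
    \<comment> \<open>The binomial coefficients vanish for \<open>k > n\<close>. A range independent
      of \<open>n\<close> allows the later interchange of sums.\<close>
    also have "\<dots> = (\<Sum>k=0..p-2. T n k * A k)"
      using that by (intro sum.mono_neutral_left) (auto simp: T_def)
    finally show ?thesis .
  qed
  have lT: "rat_cong p 1 (\<Sum>n=1..p-2. T n k * l n) (- l k)" if k: "k \<le> p - 2" for k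
  proof -
    \<comment> \<open>The eigenvector relation sums up to \<open>p - 1\<close>. Its last term may be
      dropped, having the factor \<open>harmonic (p - 1)\<close>.\<close>
    have "p - 1 = Suc (p - 2)" using p by simp
    then have "(\<Sum>n=1..p-2. T n k * l n) = (\<Sum>n=1..p-1. T n k * l n) - T (p - 1) k * l (p - 1)"
      by simp
    also have "rat_cong p 1 \<dots> (- l k - T (p - 1) k * (1 / of_nat (p - 1)) * 0)"
    proof (rule rat_cong_diff)
      show "rat_cong p 1 (\<Sum>n=1..p-1. T n k * l n) (- l k)"
        unfolding T_def l_def using p k by (intro binomial_involution_harmonic_div) auto
      have "T (p - 1) k * (1 / of_nat (p - 1)) \<in> p_integers p"
        unfolding T_def using p
        by (intro p_integers_mult p_integers_power p_integers_inverse_less p_integers_of_nat)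
          (auto intro: p_integers_uminus)
      then have "rat_cong p 1 (T (p - 1) k * (1 / of_nat (p - 1)) * harmonic (p - 1))
          (T (p - 1) k * (1 / of_nat (p - 1)) * 0)"
        using p by (intro rat_cong_mult_left harmonic_pred_prime_cong_0) auto
      then show "rat_cong p 1 (T (p - 1) k * l (p - 1)) (T (p - 1) k * (1 / of_nat (p - 1)) * 0)"
        by (simp add: l_def)
    qed
    finally show ?thesis by simp
  qed
  define S where "S = (\<Sum>k=1..p-2. l k * A k)"
  have "S = (\<Sum>n=1..p-2. \<Sum>k=0..p-2. l n * (T n k * A k))"
    unfolding S_def sum_distrib_left [symmetric]
    by (intro sum.cong refl arg_cong2 [where f = "(*)"] TA) auto
  also have "\<dots> = (\<Sum>k=0..p-2. A k * (\<Sum>n=1..p-2. T n k * l n))"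
    by (subst sum.swap) (simp add: sum_distrib_left mult_ac)
  also have "rat_cong p 1 \<dots> (\<Sum>k=0..p-2. A k * (- l k))"
    using lT int by (intro rat_cong_sum rat_cong_mult_left) auto
  \<comment> \<open>The extra term at \<open>k = 0\<close> vanishes because
    \<open>l 0 = 0\<close>.\<close>
  also have "(\<Sum>k=0..p-2. A k * (- l k)) = - S"
    unfolding S_def by (simp add: sum.atLeast_Suc_atMost l_def sum_negf mult.commute)
  finally have "rat_cong p 1 (S + S) (- S + S)"
    by (rule rat_cong_add) simp
  then have "rat_cong p 1 (of_nat 2 * S) (of_nat 2 * 0)" by simp
  moreover have "coprime 2 p"
    using p by (simp add: prime_odd_nat)
  ultimately have "rat_cong p 1 S 0"
    using rat_cong_cancel by (meson zero_less_numeral)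
  then show ?thesis by (simp add: S_def l_def)
qed

section \<open>Reduction of the main congruence to the harmonic sum\<close>

text \<open>As \<open>p\<close> is odd, the last term of the defining identity is
  \<open>- A p\<close>, which doubles \<open>A p\<close> on the other side, and the term before it
  is \<open>p * A (p - 1)\<close>. Absorption then extracts \<open>p\<close> from each remaining
  binomial coefficient.\<close>

lemma even_sequence_at_prime:
  assumes "odd p" "p \<ge> 3" and "even_sequence A"
  shows "(2 * A p - A 0 - of_nat p * A (p - 1)) / of_nat p
    = (\<Sum>k=1..p-2. A k / (of_nat p - of_nat k) * ((-1) ^ k * of_nat ((p - 1) choose k)))"
proof -
  define m where "m = p - 2"
  have m: "p = Suc (Suc m)" using assms(2) by (simp add: m_def)
  define f where "f k = of_nat (p choose k) * (-1) ^ k * A k" for k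
  have "A p = (\<Sum>k=0..p. f k)"
    using assms(3) by (simp add: even_sequence_def f_def)
  also have "\<dots> = f 0 + (\<Sum>k=1..p-2. f k) + f (p - 1) + f p"
    by (simp add: m sum.atLeast_Suc_atMost)
  finally have "2 * A p - A 0 - of_nat p * A (p - 1) = (\<Sum>k=1..p-2. f k)"
    using assms(1) by (simp add: f_def m algebra_simps)
  also have "\<dots> = (\<Sum>k=1..p-2. of_nat p *
      (A k / (of_nat p - of_nat k) * ((-1) ^ k * of_nat ((p - 1) choose k))))"
  proof (rule sum.cong [OF refl])
    fix k assume k: "k \<in> {1..p-2}"
    have "(p - k) * (p choose k) = p * ((p - 1) choose k)"
      by (rule binomial_absorb_comp)
    then have "of_nat (p - k) * (of_nat (p choose k) :: rat) = of_nat p * of_nat ((p - 1) choose k)"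
      by (metis of_nat_mult)
    moreover have "of_nat (p - k) = (of_nat p - of_nat k :: rat)" "of_nat (p - k) \<noteq> (0 :: rat)"
      using k m by auto
    ultimately have "(of_nat (p choose k) :: rat) = of_nat p * of_nat ((p - 1) choose k) / (of_nat p - of_nat k)"
      by (simp add: field_simps)
    then show "f k = of_nat p * (A k / (of_nat p - of_nat k) * ((-1) ^ k * of_nat ((p - 1) choose k)))"
      by (simp add: f_def)
  qed
  finally show ?thesis
    unfolding sum_distrib_left [symmetric] using assms(2) by simp
qed

theorem theorem4p2:
  fixes p :: nat and A :: "nat \<Rightarrow> rat"
  assumes "prime p" and "p > 3"
    and "even_sequence A"
    and "\<And>k. k \<le> p - 2 \<Longrightarrow> A k \<in> p_integers p"
    and "A p \<in> p_integers p"
    and "of_nat p * A (p - 1) \<in> p_integers p"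
  shows "rat_cong p 2
           (\<Sum>k=1..p-2. A k / (of_nat p - of_nat k))
           ((2 * A p - A 0 - of_nat p * A (p - 1)) / of_nat p)"
proof -
  define P :: rat where "P = of_nat p"
  have p0: "p > 0" and P0: "P \<noteq> 0" and odd: "odd p"
    using assms(1,2) by (auto simp: P_def prime_odd_nat)
  \<comment> \<open>The plus sign arises from \<open>1 - P * harmonic k\<close> together with
    \<open>1 / (P - k)\<close> being congruent to \<open>- 1 / k\<close> modulo
    \<open>p\<close>.\<close>
  have term_cong: "rat_cong p 2 (A k / (P - of_nat k) * ((-1) ^ k * of_nat ((p - 1) choose k)))
      (A k / (P - of_nat k) + P * (harmonic k / of_nat k * A k))"
    if k: "k \<in> {1..p-2}" for k
  proof -
    define r where "r = 1 / (P - of_nat k)"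
    define s :: rat where "s = 1 / of_nat k"
    have kp: "0 < k" "k < p" using k by auto
    have r_nat: "r = 1 / of_nat (p - k)"
      using kp by (simp add: r_def P_def)
    have "of_nat (p - k) \<noteq> (0 :: rat)" using kp by simp
    then have "P - of_nat k \<noteq> 0"
      using kp by (simp add: P_def)
    \<comment> \<open>This is \<open>1 / (P - k) + 1 / k = P / (k * (P - k))\<close>, written so
      that \<open>r\<close> is visibly \<open>- s\<close> modulo \<open>p\<close>.\<close>
    then have rs: "r = P * (r * s) - s"
      using kp by (simp add: r_def s_def field_simps)
    have ints: "r \<in> p_integers p" "s \<in> p_integers p" "A k \<in> p_integers p" "harmonic k \<in> p_integers p"
      unfolding r_nat s_def using assms(1,4) k kp p_integers_inverse_less [of p "p - k"]
      by (simp_all add: p_integers_inverse_less p_integers_harmonic del: of_nat_diff)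
    have "rat_cong p 1 (P * (r * s) - s) (0 - s)"
      unfolding P_def using ints p0
      by (intro rat_cong_diff rat_cong_of_nat_mult p_integers_mult rat_cong_refl) auto
    then have "rat_cong p 1 r (- s)" using rs by simp
    then have "rat_cong p 1 (A k * harmonic k * r) (A k * harmonic k * (- s))"
      using ints by (intro rat_cong_mult_left p_integers_mult) auto
    from rat_cong_Suc_mult [OF p0 this]
    have *: "rat_cong p 2 (P * (A k * harmonic k * r)) (P * (A k * harmonic k * (- s)))"
      unfolding P_def by (simp only: numeral_2_eq_2 One_nat_def)
    have "rat_cong p 2 (A k * r * ((-1) ^ k * of_nat ((p - 1) choose k)))
        (A k * r * (1 - P * harmonic k))"
      unfolding P_def using assms(1) kp ints
      by (intro rat_cong_mult_left choose_pred_prime_cong p_integers_mult) auto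
    also have "A k * r * (1 - P * harmonic k) = A k * r - P * (A k * harmonic k * r)"
      by (simp add: algebra_simps)
    also have "rat_cong p 2 \<dots> (A k * r - P * (A k * harmonic k * (- s)))"
      by (intro rat_cong_diff rat_cong_refl *)
    finally show ?thesis
      by (simp add: r_def s_def mult.commute)
  qed
  have "rat_cong p 2 (P * (\<Sum>k=1..p-2. harmonic k / of_nat k * A k)) (P * 0)"
    using rat_cong_Suc_mult [OF p0 sum_harmonic_even_sequence_cong_0 [OF assms(1-4)]]
    by (simp add: P_def numeral_2_eq_2)
  then have S: "rat_cong p 2 (P * (\<Sum>k=1..p-2. harmonic k / of_nat k * A k)) 0"
    by simp
  have "(2 * A p - A 0 - P * A (p - 1)) / P
      = (\<Sum>k=1..p-2. A k / (P - of_nat k) * ((-1) ^ k * of_nat ((p - 1) choose k)))"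
    unfolding P_def using assms odd by (intro even_sequence_at_prime) auto
  also have "rat_cong p 2 \<dots> (\<Sum>k=1..p-2. A k / (P - of_nat k) + P * (harmonic k / of_nat k * A k))"
    using term_cong by (rule rat_cong_sum)
  also have "\<dots> = (\<Sum>k=1..p-2. A k / (P - of_nat k)) + P * (\<Sum>k=1..p-2. harmonic k / of_nat k * A k)"
    by (simp only: sum.distrib sum_distrib_left)
  also have "rat_cong p 2 \<dots> ((\<Sum>k=1..p-2. A k / (P - of_nat k)) + 0)"
    by (intro rat_cong_add rat_cong_refl S)
  finally show ?thesis
    unfolding P_def using rat_cong_sym by simp
qed

end
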